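(* Let $\Gamma$ be a finite, undirected, connected 3-GNDB graph of diameter $2$. Then for every edge $ab$ of $\Gamma$ with $|W_{ab}|=3|W_{ba}|$, we have $\deg(a)=3\deg(b)$.
   Context: All graphs are finite, simple, undirected and connected, with at least one edge. For vertices $a,b$, $d(a,b)$ denotes the length of a shortest $a$–$b$ path. For an edge $ab$, $W_{ab}=\{x\in V(\Gamma)\mid d(x,a)<d(x,b)\}$. A graph $\Gamma$ is called generalized 3-nicely distance-balanced (3-GNDB) if there is a positive integer $\gamma_\Gamma$ such that for every edge $ab$ of $\Gamma$, one of $|W_{ab}|,|W_{ba}|$ equals $3$ times the other, and the smaller of the two equals $\gamma_\Gamma$. *)

theory Defs
  imports "Graph_Theory.Digraph_Component" "Graph_Theory.Shortest_Path"
begin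

text \<open>
  Undirected graphs are symmetric digraphs: an edge \<open>ab\<close> is the pair of arcs
  \<open>a \<rightarrow> b\<close> and \<open>b \<rightarrow> a\<close>, and \<^const>\<open>graph\<close> additionally demands finiteness, no loops
  and no parallel arcs. Consequently \<^const>\<open>out_degree\<close> is the degree of a vertex.
\<close>

definition gdist :: "('a, 'b) pre_digraph \<Rightarrow> 'a \<Rightarrow> 'a \<Rightarrow> nat" where
  "gdist G a b = (LEAST n. \<exists>p. pre_digraph.apath G a p b \<and> length p = n)"

text \<open>
  Between vertices that are joined by a path, \<open>gdist\<close> is the library's shortest-path
  cost for unit arc costs.
\<close>

lemma (in fin_digraph) gdist_eq_unit_cost_mu:
  assumes "a \<rightarrow>\<^sup>* b"
  shows "\<mu> (\<lambda>_. 1) a b = ereal (real (gdist G a b))"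
proof -
  have cost: "awalk_cost (\<lambda>_. 1) p = real (length p)" for p :: "'b list"
    by (induct p) auto
  let ?P = "\<lambda>n. \<exists>p. apath a p b \<and> length p = n"
  obtain q where q: "apath a q b" "\<mu> (\<lambda>_. 1) a b = awalk_cost (\<lambda>_. 1) q"
    using min_cost_awalk[OF assms, of "\<lambda>_. 1"] by auto
  have "?P (gdist G a b)"
    unfolding gdist_def by (rule LeastI_ex) (use q in blast)
  then obtain p where p: "apath a p b" "length p = gdist G a b" by blast
  have "gdist G a b \<le> length q"
    unfolding gdist_def by (rule Least_le) (use q in blast)
  moreover have "\<mu> (\<lambda>_. 1) a b \<le> awalk_cost (\<lambda>_. 1) p"
    using p by (intro min_cost_le_walk_cost) (auto simp: apath_def)
  ultimately show ?thesis using p q by (simp add: cost)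
qed

definition gdiameter :: "('a, 'b) pre_digraph \<Rightarrow> nat" where
  "gdiameter G = Max {gdist G u v | u v. u \<in> verts G \<and> v \<in> verts G}"

definition W :: "('a, 'b) pre_digraph \<Rightarrow> 'a \<Rightarrow> 'a \<Rightarrow> 'a set" where
  "W G a b = {x \<in> verts G. gdist G x a < gdist G x b}"

definition gndb3 :: "('a, 'b) pre_digraph \<Rightarrow> bool" where
  "gndb3 G \<longleftrightarrow> (\<exists>\<gamma>::nat. \<gamma> > 0 \<and> (\<forall>a b. a \<rightarrow>\<^bsub>G\<^esub> b \<longrightarrow>
     (card (W G a b) = 3 * card (W G b a) \<or> card (W G b a) = 3 * card (W G a b)) \<and>
     min (card (W G a b)) (card (W G b a)) = \<gamma>))"

end

theory Submission
  imports Defs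
begin

text \<open>
  In diameter 2, an edge \<open>ab\<close> lying in \<open>t\<close> triangles satisfies \<open>|W a b| = deg a - t\<close> and
  \<open>|W b a| = deg b - t\<close>, so the 3-GNDB condition makes the degrees of adjacent vertices differ by
  exactly \<open>2\<gamma>\<close>. Around a triangle three differences \<open>\<plusminus>2\<gamma>\<close> would have to sum to zero,
  which is impossible; hence \<open>t = 0\<close> and the cardinalities of \<open>W\<close> are the degrees.
\<close>

text \<open>Arcs leaving different vertices are different, so the triangles over an edge become an
  intersection only when end vertices are collected instead of arcs.\<close>

definition neighbours :: "('a, 'b) pre_digraph \<Rightarrow> 'a \<Rightarrow> 'a set" where
  "neighbours G v = {u. v \<rightarrow>\<^bsub>G\<^esub> u}"

text \<open>The \<open>LEAST\<close> in \<open>gdist\<close> is attained only if some path exists.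
  Reachability supplies one, here and in the characterisations of distances 0 and 1.\<close>

lemma (in wf_digraph) shortest_apathE:
  assumes "u \<rightarrow>\<^sup>* v"
  obtains p where "apath u p v" "length p = gdist G u v"
proof -
  have "\<exists>n p. apath u p v \<and> length p = n"
    using assms by (simp add: reachable_apath)
  then have "\<exists>p. apath u p v \<and> length p = gdist G u v"
    unfolding gdist_def by (rule LeastI_ex)
  then show ?thesis using that by blast
qed

lemma (in wf_digraph) gdist_le_length:
  assumes "apath u p v"
  shows "gdist G u v \<le> length p"
  unfolding gdist_def using assms by (blast intro: Least_le)

lemma (in wf_digraph) gdist_eq_0_iff:
  assumes "u \<rightarrow>\<^sup>* v"
  shows "gdist G u v = 0 \<longleftrightarrow> u = v"
proof
  assume "gdist G u v = 0"
  then show "u = v"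
    using shortest_apathE[OF assms] by (metis apath_Nil_iff length_0_conv)
next
  assume "u = v"
  then have "apath u [] v"
    using assms by (auto simp: apath_Nil_iff reachable_in_verts)
  then show "gdist G u v = 0"
    using gdist_le_length by fastforce
qed

lemma (in loopfree_digraph) gdist_eq_1_iff:
  assumes "u \<rightarrow>\<^sup>* v"
  shows "gdist G u v = 1 \<longleftrightarrow> u \<rightarrow> v"
proof
  assume "gdist G u v = 1"
  then obtain p where "apath u p v" "length p = 1"
    using shortest_apathE[OF assms] by metis
  then show "u \<rightarrow> v"
    by (auto simp: length_Suc_conv apath_simps arcs_ends_conv)
next
  assume "u \<rightarrow> v"
  then obtain e where e: "e \<in> arcs G" "tail G e = u" "head G e = v"
    by (auto simp: arcs_ends_conv)
  \<comment> \<open>Distinct ends make the single arc \<open>e\<close> a path and not a closed walk,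
    and they rule out distance 0.\<close>
  then have "u \<noteq> v"
    using no_loops by metis
  with e have "apath u [e] v"
    by (auto simp: apath_simps)
  then have "gdist G u v \<le> 1"
    using gdist_le_length by fastforce
  moreover have "gdist G u v \<noteq> 0"
    using gdist_eq_0_iff[OF assms] \<open>u \<noteq> v\<close> by simp
  ultimately show "gdist G u v = 1"
    by simp
qed

lemma (in fin_digraph) gdist_le_gdiameter:
  assumes "u \<in> verts G" "v \<in> verts G"
  shows "gdist G u v \<le> gdiameter G"
proof -
  \<comment> \<open>\<open>Max\<close> bounds the elements of a finite set only; as an image of a
    finite product the set of distances is visibly finite.\<close>
  have "{gdist G u v | u v. u \<in> verts G \<and> v \<in> verts G}
      = (\<lambda>(u, v). gdist G u v) ` (verts G \<times> verts G)"
    by auto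
  then have "finite {gdist G u v | u v. u \<in> verts G \<and> v \<in> verts G}"
    by simp
  then show ?thesis
    unfolding gdiameter_def using assms by (blast intro: Max_ge)
qed

lemma (in sym_digraph) adj_commute: "u \<rightarrow> v \<longleftrightarrow> v \<rightarrow> u"
  using sym_arcs unfolding symmetric_def by (auto dest: symD)

lemma (in wf_digraph) neighbours_subset_verts: "neighbours G v \<subseteq> verts G"
  unfolding neighbours_def using adj_in_verts by blast

lemma (in fin_digraph) finite_neighbours: "finite (neighbours G v)"
  using neighbours_subset_verts finite_verts by (rule finite_subset)

text \<open>Without parallel arcs, \<open>head\<close> is injective on the arcs leaving
  \<open>v\<close>.\<close>

lemma (in nomulti_digraph) out_degree_eq_card_neighbours:
  "out_degree G v = card (neighbours G v)"
proof -
  have "inj_on (head G) (out_arcs G v)"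
    by (auto intro!: inj_onI no_multi_arcs simp: arc_to_ends_def)
  moreover have "head G ` out_arcs G v = neighbours G v"
    by (auto simp: neighbours_def arcs_ends_conv)
  ultimately show ?thesis
    unfolding out_degree_def by (metis card_image)
qed

text \<open>All distances are 0, 1 or 2, so a vertex closer to \<open>a\<close> than to
  \<open>b\<close> is \<open>a\<close> itself or a neighbour of \<open>a\<close> at distance 2 from
  \<open>b\<close>. The additive form avoids subtraction on naturals.\<close>

lemma (in graph) card_W_add_card_common_neighbours:
  assumes conn: "strongly_connected G" and diam: "gdiameter G = 2" and ab: "a \<rightarrow> b"
  shows "card (W G a b) + card (neighbours G a \<inter> neighbours G b) = out_degree G a"
proof -
  let ?N = "neighbours G"
  have in_verts: "a \<in> verts G" "b \<in> verts G"
    using ab adj_in_verts by blast+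
  have "a \<noteq> b"
    using ab adj_not_same by blast
  have reach: "x \<rightarrow>\<^sup>* y" if "x \<in> verts G" "y \<in> verts G" for x y
    using conn that by auto
  have "x \<in> W G a b \<longleftrightarrow> x = a \<or> x \<in> ?N a \<and> x \<notin> ?N b \<and> x \<noteq> b" if x: "x \<in> verts G" for x
  proof -
    note r = reach[OF x in_verts(1)] reach[OF x in_verts(2)]
    have "gdist G x b \<le> 2"
      using gdist_le_gdiameter[OF x in_verts(2)] diam by simp
    then have "gdist G x a < gdist G x b \<longleftrightarrow>
        gdist G x a = 0 \<and> gdist G x b \<noteq> 0 \<or>
        gdist G x a = 1 \<and> gdist G x b \<noteq> 0 \<and> gdist G x b \<noteq> 1"
      by linarith
    also have "\<dots> \<longleftrightarrow> x = a \<and> x \<noteq> b \<or> x \<rightarrow> a \<and> x \<noteq> b \<and> \<not> x \<rightarrow> b"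
      by (simp only: gdist_eq_0_iff[OF r(1)] gdist_eq_0_iff[OF r(2)]
          gdist_eq_1_iff[OF r(1)] gdist_eq_1_iff[OF r(2)])
    finally show ?thesis
      using x \<open>a \<noteq> b\<close> adj_commute unfolding W_def neighbours_def by blast
  qed
  then have W: "W G a b = insert a (?N a - ?N b - {b})"
    using in_verts neighbours_subset_verts[of a] unfolding W_def by blast
  have "a \<notin> ?N a" "b \<notin> ?N b" "b \<in> ?N a"
    using ab adj_not_same by (auto simp: neighbours_def)
  \<comment> \<open>\<open>b\<close> lies in \<open>?N a - ?N b\<close> and \<open>a\<close> does
    not, so removing \<open>b\<close> and inserting \<open>a\<close> keeps the size.\<close>
  then have "card (W G a b) = card (?N a - ?N b)"
    unfolding W using finite_neighbours card_Suc_Diff1[of "?N a - ?N b" b] by simp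
  moreover have "card (?N a) = card (?N a \<inter> ?N b) + card (?N a - ?N b)"
    using card_Int_Diff[OF finite_neighbours] .
  ultimately show ?thesis
    by (simp add: out_degree_eq_card_neighbours)
qed

theorem theorem2p2:
  fixes G :: "('a, 'b) pre_digraph" and a b :: 'a
  assumes "graph G" and "Digraph_Component.connected G" and "arcs G \<noteq> {}"
    and "gndb3 G" and "gdiameter G = 2"
    and "a \<rightarrow>\<^bsub>G\<^esub> b" and "card (W G a b) = 3 * card (W G b a)"
  shows "out_degree G a = 3 * out_degree G b"
proof -
  interpret graph G by fact
  let ?N = "neighbours G"
  let ?deg = "out_degree G"
  have "strongly_connected G"
    using sym_arcs assms(2) by (rule symmetric_connected_imp_strongly_connected)
  then have W: "card (W G x y) + card (?N x \<inter> ?N y) = ?deg x" if "x \<rightarrow>\<^bsub>G\<^esub> y" for x y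
    using card_W_add_card_common_neighbours assms(5) that by blast
  \<comment> \<open>The reversed edge has the same common neighbours; written as the same term,
    their number cancels against \<open>W\<close> in linear arithmetic.\<close>
  have W': "card (W G y x) + card (?N x \<inter> ?N y) = ?deg y" if "x \<rightarrow>\<^bsub>G\<^esub> y" for x y
    using W[of y x] that adj_commute by (simp add: Int_commute)
  obtain \<gamma> where "\<gamma> > 0" and \<gamma>: "\<And>x y. x \<rightarrow>\<^bsub>G\<^esub> y \<Longrightarrow>
     (card (W G x y) = 3 * card (W G y x) \<or> card (W G y x) = 3 * card (W G x y)) \<and>
     min (card (W G x y)) (card (W G y x)) = \<gamma>"
    using assms(4) unfolding gndb3_def by blast
  \<comment> \<open>The two cardinalities are \<gamma> and 3\<gamma> in some order, and the degrees
    differ by as much as they do.\<close>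
  have deg: "?deg x = ?deg y + 2 * \<gamma> \<or> ?deg y = ?deg x + 2 * \<gamma>" if "x \<rightarrow>\<^bsub>G\<^esub> y" for x y
    using \<gamma>[OF that] W[OF that] W'[OF that] by linarith
  \<comment> \<open>Each choice of the three signs would make an odd multiple of 2\<gamma>
    vanish.\<close>
  have "\<not> (a \<rightarrow>\<^bsub>G\<^esub> c \<and> b \<rightarrow>\<^bsub>G\<^esub> c)" for c
    using deg[OF assms(6)] deg[of a c] deg[of b c] \<open>\<gamma> > 0\<close> by linarith
  then have "?N a \<inter> ?N b = {}"
    by (auto simp: neighbours_def)
  then show ?thesis
    using W[OF assms(6)] W'[OF assms(6)] assms(7) by simp
qed

end
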